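(* Let $\Omega\subset\mathbb{C}^d$ be a $\mathbb{C}$-proper convex open set such that $(\Omega,d_\Omega)$ is Gromov hyperbolic. Suppose $\widehat{\Omega}\subset\mathbb{C}^d$ is a $\mathbb{C}$-proper convex open set lying in the closure of the orbit $\mathrm{Aff}(\mathbb{C}^d)\Omega$ in the local Hausdorff topology (e.g. $A_n\Omega\to\widehat\Omega$ for some complex affine maps $A_n$). Then $(\widehat{\Omega},d_{\widehat{\Omega}})$ is Gromov hyperbolic.
   Context: An open convex set is $\mathbb{C}$-proper if it contains no complex affine line. $d_\Omega$ is the Kobayashi distance. $\mathrm{Aff}(\mathbb{C}^d)$ is the group of complex affine transformations of $\mathbb{C}^d$. Local Hausdorff topology: with $d_H$ the Hausdorff distance on compact sets and $B_R(0)$ the Euclidean ball, a sequence of open convex sets $A_n$ converges to an open convex set $A$ if $d_H(\overline{A_n}\cap\overline{B_R(0)},\overline{A}\cap\overline{B_R(0)})\to0$ for every $R>0$. *)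

theory Defs
  imports "HOL-Analysis.Analysis"
begin

definition C_proper :: "(complex ^ 'd) set \<Rightarrow> bool" where
  "C_proper \<Omega> \<longleftrightarrow> \<not> (\<exists>a v. v \<noteq> 0 \<and> (\<forall>z::complex. a + z *s v \<in> \<Omega>))"

definition poincare_dist :: "complex \<Rightarrow> complex \<Rightarrow> real" where
  "poincare_dist a b = artanh (cmod (a - b) / cmod (1 - cnj a * b))"

definition hol_disc :: "(complex ^ 'd) set \<Rightarrow> (complex \<Rightarrow> complex ^ 'd) \<Rightarrow> bool" where
  "hol_disc \<Omega> f \<longleftrightarrow> (\<forall>i. (\<lambda>z. f z $ i) holomorphic_on ball 0 1) \<and> f ` ball 0 1 \<subseteq> \<Omega>"

definition kobayashi_dist :: "(complex ^ 'd) set \<Rightarrow> complex ^ 'd \<Rightarrow> complex ^ 'd \<Rightarrow> real" where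
  "kobayashi_dist \<Omega> x y = Inf {(\<Sum>j<m. poincare_dist (a j) (b j)) | m f a b p.
      p 0 = x \<and> p m = y \<and>
      (\<forall>j<m. hol_disc \<Omega> (f j) \<and> a j \<in> ball 0 1 \<and> b j \<in> ball 0 1 \<and>
              f j (a j) = p j \<and> f j (b j) = p (Suc j))}"

definition gromov_product :: "('a \<Rightarrow> 'a \<Rightarrow> real) \<Rightarrow> 'a \<Rightarrow> 'a \<Rightarrow> 'a \<Rightarrow> real" where
  "gromov_product d w x y = (d x w + d y w - d x y) / 2"

definition gromov_hyperbolic :: "'a set \<Rightarrow> ('a \<Rightarrow> 'a \<Rightarrow> real) \<Rightarrow> bool" where
  "gromov_hyperbolic S d \<longleftrightarrow> (\<exists>\<delta>\<ge>0. \<forall>x\<in>S. \<forall>y\<in>S. \<forall>z\<in>S. \<forall>w\<in>S.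
      gromov_product d w x z \<ge> min (gromov_product d w x y) (gromov_product d w y z) - \<delta>)"

definition complex_affine :: "(complex ^ 'd \<Rightarrow> complex ^ 'd) \<Rightarrow> bool" where
  "complex_affine A \<longleftrightarrow> (\<exists>(M::complex^'d^'d) b. invertible M \<and> (\<forall>z. A z = M *v z + b))"

text \<open>Hausdorff distance between compact sets is \<open>\<le> \<epsilon>\<close> iff each lies in the closed
  \<open>\<epsilon>\<close>-neighbourhood of the other (with \<open>d_H(\<emptyset>,K) = \<infinity>\<close> for \<open>K \<noteq> \<emptyset>\<close>).\<close>
definition hausdorff_le :: "('a::metric_space) set \<Rightarrow> 'a set \<Rightarrow> real \<Rightarrow> bool" where
  "hausdorff_le K L \<epsilon> \<longleftrightarrow> K \<subseteq> (\<Union>y\<in>L. cball y \<epsilon>) \<and> L \<subseteq> (\<Union>x\<in>K. cball x \<epsilon>)"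

definition local_hausdorff_conv :: "(nat \<Rightarrow> (complex ^ 'd) set) \<Rightarrow> (complex ^ 'd) set \<Rightarrow> bool" where
  "local_hausdorff_conv An A \<longleftrightarrow> (\<forall>R>0. \<forall>\<epsilon>>0. eventually (\<lambda>n.
      hausdorff_le (closure (An n) \<inter> cball 0 R) (closure A \<inter> cball 0 R) \<epsilon>) sequentially)"

end

theory Submission
  imports Defs "HOL-Complex_Analysis.Riemann_Mapping"
begin

text \<open>
  Complex affine maps are isometries for the Kobayashi distances, so it suffices to show that
  \<open>kobayashi_dist (V n) x y\<close> tends to \<open>kobayashi_dist W x y\<close> whenever the convex domains \<open>V n\<close>
  converge to \<open>W\<close>; the four-point inequality then passes to the limit with the same constant.

  For the upper bound, each disc of an almost optimal chain in \<open>W\<close> is replaced by \<open>z \<mapsto> f (\<rho> z)\<close> with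
  \<open>\<rho> < 1\<close> near 1; its image is relatively compact in \<open>W\<close>, hence eventually contained in \<open>V n\<close>.

  For the lower bound, C-properness of \<open>W\<close> and compactness of the unit sphere give a constant \<open>M\<close> such
  that every complex line through \<open>x\<close> leaves \<open>V n\<close> at distance at most \<open>M\<close>, for all large \<open>n\<close>.
  Separating \<open>V n\<close> from such a point and applying the Schwarz lemma in the resulting half-plane bounds
  every point reachable from \<open>x\<close> by a chain of length \<open>L\<close> by \<open>norm x + (1 + exp (2 * L)) * M\<close>. So the
  shrunken discs \<open>z \<mapsto> f (r z)\<close> of a chain in \<open>V n\<close> stay in a fixed ball, where a homothety of ratio
  \<open>\<mu> < 1\<close> about \<open>x\<close> maps \<open>V n\<close> into \<open>W\<close>. The shrinking costs only a factor \<open>1 + \<eta>\<close> in length,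
  independently of the number of discs.
\<close>

subsection \<open>Chains of discs\<close>

lemma norm_vector_scalar_mult:
  fixes v :: "complex ^ 'n"
  shows "norm (c *s v) = cmod c * norm v"
  by (simp add: norm_vec_def norm_mult L2_set_right_distrib)

lemma artanh_nonneg_real:
  fixes t :: real
  assumes "0 \<le> t" "t < 1"
  shows "0 \<le> artanh t"
  using assms by (auto simp: artanh_def intro!: ln_ge_zero)

lemma exp_twice_artanh:
  fixes t :: real
  assumes "0 \<le> t" "t < 1"
  shows "exp (2 * artanh t) = (1 + t) / (1 - t)"
  using assms by (simp add: artanh_def)

text \<open>Since \<open>poincare_dist\<close> is invariant under disc automorphisms, every link of a chain may be
  normalised to join \<open>f 0\<close> to \<open>f t\<close> with \<open>0 \<le> t < 1\<close>, at cost \<open>artanh t\<close>.\<close>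
inductive disc_chain :: "(complex ^ 'd) set \<Rightarrow> real \<Rightarrow> complex ^ 'd \<Rightarrow> complex ^ 'd \<Rightarrow> bool" for W where
  refl: "disc_chain W 0 x x"
| step: "disc_chain W L x p \<Longrightarrow> hol_disc W f \<Longrightarrow> f 0 = p \<Longrightarrow> 0 \<le> t \<Longrightarrow> t < 1 \<Longrightarrow> f (of_real t) = q
    \<Longrightarrow> disc_chain W (L + artanh t) x q"

lemma disc_chain_single:
  assumes "hol_disc W f" "f 0 = x" "0 \<le> t" "t < 1" "f (of_real t) = y"
  shows "disc_chain W (artanh t) x y"
  using disc_chain.step[OF disc_chain.refl assms] by simp

lemma disc_chain_nonneg: "disc_chain W L x y \<Longrightarrow> 0 \<le> L"
  by (induction rule: disc_chain.induct) (auto dest: artanh_nonneg_real)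

lemma disc_chain_trans:
  assumes "disc_chain W L2 y z" "disc_chain W L1 x y"
  shows "disc_chain W (L1 + L2) x z"
  using assms
proof (induction rule: disc_chain.induct)
  case (step L x' p f t q)
  have "disc_chain W ((L1 + L) + artanh t) x q"
    using step by (intro disc_chain.step[of W "L1 + L" x p f t q]) auto
  then show ?case by (simp add: add.assoc)
qed simp

lemma hol_disc_compose:
  assumes "hol_disc W f" "g holomorphic_on ball 0 1" "g ` ball 0 1 \<subseteq> ball 0 1"
  shows "hol_disc W (f \<circ> g)"
  unfolding hol_disc_def
proof (intro conjI allI)
  fix i
  have "(\<lambda>z. f z $ i) \<circ> g holomorphic_on ball 0 1"
    using assms by (intro holomorphic_on_compose_gen[where t = "ball 0 1"]) (auto simp: hol_disc_def)
  then show "(\<lambda>z. (f \<circ> g) z $ i) holomorphic_on ball 0 1"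
    by (simp add: o_def)
  show "(f \<circ> g) ` ball 0 1 \<subseteq> W"
    using assms by (fastforce simp: hol_disc_def)
qed

text \<open>\<open>f\<close> is precomposed with the disc automorphism taking 0 to \<open>a\<close>
  and a nonnegative real number to \<open>b\<close>; that number is the modulus of the image of
  \<open>b\<close> under the automorphism moving \<open>a\<close> to 0.\<close>

lemma hol_disc_normalise:
  assumes f: "hol_disc W f" and ab: "a \<in> ball 0 1" "b \<in> ball 0 1"
  obtains g t where "hol_disc W g" "g 0 = f a" "0 \<le> t" "t < 1" "g (of_real t) = f b"
    "artanh t = poincare_dist a b"
proof -
  define w where "w = Moebius_function 0 a b"
  \<comment> \<open>\<open>c\<close> rotates \<open>cmod w\<close> to \<open>w\<close>; the value 1
    at \<open>w = 0\<close> keeps it unimodular, since \<open>sgn 0 = 0\<close>.\<close>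
  define c where "c = (if w = 0 then 1 else sgn w)"
  define \<phi> where "\<phi> = Moebius_function 0 (- a) \<circ> (\<lambda>z. c * z)"
  have w1: "cmod w < 1"
    using ab by (auto simp: w_def intro: Moebius_function_norm_lt_1)
  have c1: "cmod c = 1" by (simp add: c_def norm_sgn)
  have cw: "c * of_real (cmod w) = w" by (simp add: c_def sgn_eq)
  have holo: "\<phi> holomorphic_on ball 0 1"
    unfolding \<phi>_def
    using ab c1
    by (intro holomorphic_on_compose_gen[where t = "ball 0 1"] Moebius_function_holomorphic holomorphic_intros)
       (auto simp: norm_mult)
  have im: "\<phi> ` ball 0 1 \<subseteq> ball 0 1"
    using ab c1 by (auto simp: \<phi>_def norm_mult intro!: Moebius_function_norm_lt_1)
  have "\<phi> 0 = a" by (simp add: \<phi>_def Moebius_function_def)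
  moreover have "\<phi> (of_real (cmod w)) = b"
    using ab by (simp add: \<phi>_def cw) (simp add: w_def Moebius_function_compose)
  moreover have "artanh (cmod w) = poincare_dist a b"
    by (simp add: poincare_dist_def w_def Moebius_function_simple norm_divide norm_minus_commute)
  ultimately show thesis
    using that[of "f \<circ> \<phi>" "cmod w"] hol_disc_compose[OF f holo im] w1 by simp
qed

text \<open>Normalising the links of an indexed chain keeps their costs, and conversely a new link
  is stored at index \<open>m\<close>. This makes rule induction over chains available.\<close>

lemma kobayashi_dist_eq_Inf_disc_chain:
  "kobayashi_dist W x y = Inf {L. disc_chain W L x y}"
proof -
  have 1: "disc_chain W (\<Sum>j<m. poincare_dist (a j) (b j)) (p 0) (p m)"
    if "\<forall>j<m. hol_disc W (f j) \<and> a j \<in> ball 0 1 \<and> b j \<in> ball 0 1 \<and>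
              f j (a j) = p j \<and> f j (b j) = p (Suc j)" for m f a b p
    using that
  proof (induction m)
    case 0
    show ?case by (simp add: disc_chain.refl)
  next
    case (Suc m)
    then have f: "hol_disc W (f m)" "a m \<in> ball 0 1" "b m \<in> ball 0 1"
      "f m (a m) = p m" "f m (b m) = p (Suc m)" by auto
    obtain g t where "hol_disc W g" "g 0 = f m (a m)" "0 \<le> t" "t < 1" "g (of_real t) = f m (b m)"
      "artanh t = poincare_dist (a m) (b m)"
      using hol_disc_normalise[OF f(1-3)] by metis
    then have "disc_chain W ((\<Sum>j<m. poincare_dist (a j) (b j)) + artanh t) (p 0) (p (Suc m))"
      using f Suc by (intro disc_chain.step[of _ _ _ "p m" g]) auto
    then show ?case using \<open>artanh t = _\<close> by simp
  qed
  have 2: "\<exists>m f a b p. L = (\<Sum>j<m. poincare_dist (a j) (b j)) \<and> p 0 = x \<and> p m = y \<and>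
      (\<forall>j<m. hol_disc W (f j) \<and> a j \<in> ball 0 1 \<and> b j \<in> ball 0 1 \<and>
              f j (a j) = p j \<and> f j (b j) = p (Suc j))"
    if "disc_chain W L x y" for L
    using that
  proof (induction rule: disc_chain.induct)
    case (refl x)
    show ?case by (rule exI[of _ 0]) auto
  next
    case (step L x q g t r)
    from step.IH obtain m f a b p where m: "L = (\<Sum>j<m. poincare_dist (a j) (b j))" "p 0 = x" "p m = q"
      "\<forall>j<m. hol_disc W (f j) \<and> a j \<in> ball 0 1 \<and> b j \<in> ball 0 1 \<and>
              f j (a j) = p j \<and> f j (b j) = p (Suc j)" by (elim exE conjE)
    define f' where "f' = f(m := g)"
    define a' where "a' = a(m := 0)"
    define b' where "b' = b(m := complex_of_real t)"
    define p' where "p' = p(Suc m := r)"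
    have "L + artanh t = (\<Sum>j<Suc m. poincare_dist (a' j) (b' j))"
      using step by (simp add: m a'_def b'_def poincare_dist_def)
    moreover have "p' 0 = x" "p' (Suc m) = r" by (auto simp: p'_def m)
    moreover have "\<forall>j<Suc m. hol_disc W (f' j) \<and> a' j \<in> ball 0 1 \<and> b' j \<in> ball 0 1 \<and>
              f' j (a' j) = p' j \<and> f' j (b' j) = p' (Suc j)"
      using m step by (auto simp: f'_def a'_def b'_def p'_def less_Suc_eq)
    ultimately show ?case by (intro exI conjI)
  qed
  show ?thesis
    unfolding kobayashi_dist_def
  proof (intro arg_cong[where f = Inf] equalityI subsetI; elim CollectE exE conjE; intro CollectI)
    fix L m f a b p
    assume "L = (\<Sum>j<m. poincare_dist (a j) (b j))" "p 0 = x" "p m = y"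
      "\<forall>j<m. hol_disc W (f j) \<and> a j \<in> ball 0 1 \<and> b j \<in> ball 0 1 \<and>
              f j (a j) = p j \<and> f j (b j) = p (Suc j)"
    then show "disc_chain W L x y" using 1[of m f a b p] by simp
  qed (rule 2)
qed

lemma kobayashi_dist_le:
  assumes "disc_chain W L x y"
  shows "kobayashi_dist W x y \<le> L"
  unfolding kobayashi_dist_eq_Inf_disc_chain
  using assms by (intro cInf_lower bdd_belowI[of _ 0]) (auto dest: disc_chain_nonneg)

text \<open>One affine disc of radius \<open>s\<close> about \<open>x\<close> in the direction of
  \<open>y - x\<close> suffices (constant if \<open>x = y\<close>).\<close>

lemma disc_chain_short:
  assumes "ball x s \<subseteq> W" "dist x y < s"
  shows "disc_chain W (artanh (dist x y / s)) x y"
proof (rule disc_chain_single)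
  define c where "c = complex_of_real (if x = y then 0 else s / dist x y)"
  define f where "f z = x + (z * c) *s (y - x)" for z
  have s: "0 < s" using assms(2) by (meson le_less_trans zero_le_dist)
  show "hol_disc W f"
    unfolding hol_disc_def
  proof (intro conjI allI)
    show "(\<lambda>z. f z $ i) holomorphic_on ball 0 1" for i
      by (auto simp: f_def intro!: holomorphic_intros)
    have "dist x (f z) < s" if "cmod z < 1" for z
    proof -
      have "dist x (f z) = cmod z * (cmod c * dist x y)"
        by (simp add: f_def dist_norm norm_vector_scalar_mult norm_mult norm_minus_commute
            del: vector_ssub_ldistrib)
      also have "\<dots> \<le> cmod z * s"
        using s by (intro mult_left_mono) (auto simp: c_def norm_divide)
      also have "\<dots> < s" using that s by simp
      finally show ?thesis .
    qed
    then show "f ` ball 0 1 \<subseteq> W" using assms(1) by auto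
  qed
  show "f 0 = x" by (simp add: f_def)
  show "0 \<le> dist x y / s" "dist x y / s < 1" using s assms(2) by auto
  show "f (of_real (dist x y / s)) = y"
    using s by (cases "x = y") (auto simp: f_def c_def)
qed

text \<open>Near-optimal chains exist only if the infimum runs over a nonempty set. The compact
  segment from \<open>x\<close> to \<open>y\<close> has a uniform margin \<open>s\<close> inside
  \<open>W\<close>, so steps shorter than \<open>s\<close> are covered by affine discs.\<close>

lemma disc_chain_exists:
  assumes "open W" "convex W" "x \<in> W" "y \<in> W"
  shows "\<exists>L. disc_chain W L x y"
proof -
  have "closed_segment x y \<subseteq> W" using assms by (intro closed_segment_subset) auto
  then obtain s where s: "s > 0" "(\<Union>u\<in>closed_segment x y. ball u s) \<subseteq> W"
    using compact_subset_open_imp_ball_epsilon_subset[OF compact_segment assms(1)] by blast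
  obtain m :: nat where m: "dist x y / s < real m" using reals_Archimedean2 by blast
  then have m0: "m > 0" using s by (metis divide_nonneg_pos not_gr_zero not_less of_nat_0 zero_le_dist)
  define p where "p k = x + (real k / real m) *\<^sub>R (y - x)" for k
  have "\<exists>L. disc_chain W L x (p k)" if "k \<le> m" for k
    using that
  proof (induction k)
    case 0
    show ?case using disc_chain.refl by (auto simp: p_def)
  next
    case (Suc k)
    then obtain L where L: "disc_chain W L x (p k)" by auto
    have "p k = (1 - real k / real m) *\<^sub>R x + (real k / real m) *\<^sub>R y"
      by (simp add: p_def algebra_simps)
    then have "p k \<in> closed_segment x y"
      using Suc.prems m0 unfolding closed_segment_def by (auto intro!: exI[of _ "real k / real m"])
    then have "ball (p k) s \<subseteq> W" using s by blast
    moreover have "dist (p k) (p (Suc k)) < s"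
    proof -
      have "p k - p (Suc k) = (1 / real m) *\<^sub>R (x - y)"
        by (simp add: p_def algebra_simps add_divide_distrib)
      then have "dist (p k) (p (Suc k)) = dist x y / real m"
        by (simp add: dist_norm)
      also have "\<dots> < s" using m m0 s by (simp add: field_simps)
      finally show ?thesis .
    qed
    ultimately show ?case using disc_chain_trans[OF disc_chain_short L] by blast
  qed
  from this[of m] show ?thesis using m0 by (simp add: p_def)
qed

lemma disc_chain_near_kobayashi_dist:
  assumes "open W" "convex W" "x \<in> W" "y \<in> W" "kobayashi_dist W x y < c"
  obtains L where "disc_chain W L x y" "L < c"
  using cInf_lessD[of "{L. disc_chain W L x y}" c] disc_chain_exists[OF assms(1-4)] assms(5)
  by (auto simp: kobayashi_dist_eq_Inf_disc_chain)

lemma kobayashi_dist_triangle: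
  assumes "open W" "convex W" "x \<in> W" "y \<in> W" "z \<in> W"
  shows "kobayashi_dist W x z \<le> kobayashi_dist W x y + kobayashi_dist W y z"
proof (rule field_le_epsilon)
  fix e :: real assume "e > 0"
  obtain L1 where "disc_chain W L1 x y" "L1 < kobayashi_dist W x y + e / 2"
    using disc_chain_near_kobayashi_dist[OF assms(1-4), of "kobayashi_dist W x y + e / 2"] \<open>e > 0\<close> by auto
  moreover obtain L2 where "disc_chain W L2 y z" "L2 < kobayashi_dist W y z + e / 2"
    using disc_chain_near_kobayashi_dist[OF assms(1,2,4,5), of "kobayashi_dist W y z + e / 2"] \<open>e > 0\<close> by auto
  ultimately show "kobayashi_dist W x z \<le> kobayashi_dist W x y + kobayashi_dist W y z + e"
    using kobayashi_dist_le[OF disc_chain_trans] by fastforce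
qed

section \<open>Invariance under complex affine maps\<close>

lemma hol_disc_affine:
  fixes M :: "complex ^ 'd ^ 'd"
  assumes "hol_disc W f"
  shows "hol_disc ((\<lambda>z. M *v z + b) ` W) ((\<lambda>z. M *v z + b) \<circ> f)"
  using assms unfolding hol_disc_def
  by (auto simp: matrix_vector_mult_def intro!: holomorphic_intros)

lemma disc_chain_affine:
  fixes M :: "complex ^ 'd ^ 'd"
  assumes "disc_chain W L x y"
  shows "disc_chain ((\<lambda>z. M *v z + b) ` W) L (M *v x + b) (M *v y + b)"
  using assms
proof (induction rule: disc_chain.induct)
  case (step L x p f t q)
  show ?case
    by (rule disc_chain.step[OF step.IH hol_disc_affine[OF step.hyps(2)]]) (use step.hyps in auto)
qed (rule disc_chain.refl)

lemma complex_affine_inverse: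
  assumes "complex_affine A"
  obtains B where "complex_affine B" "\<And>z. B (A z) = z" "\<And>z. A (B z) = z"
proof -
  obtain M b where "invertible M" and A: "\<And>z. A z = M *v z + b"
    using assms unfolding complex_affine_def by blast
  then obtain N where N: "M ** N = mat 1" "N ** M = mat 1"
    unfolding invertible_def by blast
  then have "invertible N" unfolding invertible_def by blast
  show thesis
  proof
    show "complex_affine (\<lambda>z. N *v z + - (N *v b))"
      unfolding complex_affine_def using \<open>invertible N\<close> by blast
    show "N *v A z + - (N *v b) = z" for z
      by (simp add: A matrix_vector_right_distrib matrix_vector_mul_assoc N)
    have "A (N *v z + - (N *v b)) = M *v (N *v (z - b)) + b" for z
      by (simp add: A matrix_vector_mult_diff_distrib)
    then show "A (N *v z + - (N *v b)) = z" for z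
      by (simp add: matrix_vector_mul_assoc N)
  qed
qed

lemma disc_chain_complex_affine_iff:
  assumes "complex_affine A"
  shows "disc_chain (A ` W) L (A x) (A y) \<longleftrightarrow> disc_chain W L x y"
proof -
  have *: "disc_chain (A ` W) L (A x) (A y)" if "complex_affine A" "disc_chain W L x y"
    for A :: "complex ^ 'd \<Rightarrow> complex ^ 'd" and W x y
  proof -
    obtain M b where "A = (\<lambda>z. M *v z + b)"
      using \<open>complex_affine A\<close> unfolding complex_affine_def fun_eq_iff by blast
    then show ?thesis using disc_chain_affine[OF that(2)] by blast
  qed
  obtain B where B: "complex_affine B" "\<And>z. B (A z) = z"
    using complex_affine_inverse[OF assms] by metis
  show ?thesis
    using *[OF assms, of W x y] *[OF B(1), of "A ` W" "A x" "A y"] by (auto simp: image_image B)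
qed

lemma kobayashi_dist_complex_affine:
  assumes "complex_affine A"
  shows "kobayashi_dist (A ` W) (A x) (A y) = kobayashi_dist W x y"
  by (simp add: kobayashi_dist_eq_Inf_disc_chain disc_chain_complex_affine_iff[OF assms])

lemma open_convex_complex_affine_image:
  assumes "complex_affine A" "open W" "convex W"
  shows "open (A ` W)" "convex (A ` W)"
proof -
  have cont: "continuous_on UNIV B" if "complex_affine B" for B :: "complex ^ 'd \<Rightarrow> complex ^ 'd"
  proof -
    obtain M b where "B = (\<lambda>z. M *v z + b)"
      using \<open>complex_affine B\<close> unfolding complex_affine_def fun_eq_iff by blast
    then show ?thesis
      unfolding matrix_vector_mult_def
      by (auto intro!: continuous_intros)
  qed
  obtain B where B: "complex_affine B" "\<And>z. B (A z) = z" "\<And>z. A (B z) = z"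
    using complex_affine_inverse[OF assms(1)] by blast
  have "A ` W = B -` W" using B by (auto simp: image_iff) metis
  then show "open (A ` W)"
    using cont[OF B(1)] assms(2) by (simp add: continuous_on_open_vimage)
  obtain M b where A: "A = (\<lambda>z. M *v z + b)"
    using assms(1) unfolding complex_affine_def fun_eq_iff by blast
  have "linear ((*v) M)"
    by (rule linearI) (auto simp: matrix_vector_mult_def distrib_left sum.distrib vec_eq_iff scaleR_sum_right)
  then have "convex ((*v) M ` W)" using assms(3) by (rule convex_linear_image)
  then have "convex ((\<lambda>z. b + z) ` ((*v) M ` W))" by (rule convex_translation)
  then show "convex (A ` W)" by (simp add: A image_image add.commute)
qed

section \<open>Estimates for the inverse hyperbolic tangent\<close>

lemma artanh_mono_real:
  fixes s t :: real
  assumes "0 \<le> s" "s \<le> t" "t < 1"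
  shows "artanh s \<le> artanh t"
  using assms by (auto simp: artanh_def intro!: frac_le)

text \<open>The bound is \<open>tanh D\<close>. It keeps the parameters of all links in a chain of
  length at most \<open>D\<close> away from 1.\<close>

lemma artanh_le_imp_le:
  fixes t :: real
  assumes "0 \<le> t" "t < 1" "artanh t \<le> D"
  shows "t \<le> (exp (2 * D) - 1) / (exp (2 * D) + 1)"
proof -
  have "(1 + t) / (1 - t) \<le> exp (2 * D)"
    using assms by (subst exp_twice_artanh[symmetric]) auto
  then have "1 + t \<le> exp (2 * D) * (1 - t)"
    using assms by (simp add: field_simps)
  moreover have "exp (2 * D) + 1 > 0" by (simp add: add_pos_pos)
  ultimately show ?thesis by (simp add: field_simps)
qed

text \<open>Continuity of \<open>artanh\<close> at \<open>t\<close>. The radius depends on the link,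
  which is enough for the upper bound, where the chain is fixed.\<close>

lemma artanh_divide_near:
  fixes t e :: real
  assumes "0 \<le> t" "t < 1" "0 < e"
  obtains \<rho> where "t < \<rho>" "\<rho> < 1" "artanh (t / \<rho>) < artanh t + e"
proof -
  have "((\<lambda>\<rho>. t / \<rho>) \<longlongrightarrow> t / 1) (at_left 1)" by (intro tendsto_intros) auto
  then have "((\<lambda>\<rho>. artanh (t / \<rho>)) \<longlongrightarrow> artanh t) (at_left 1)"
    using assms by (intro isCont_tendsto_compose[OF isCont_artanh]) auto
  then have "eventually (\<lambda>\<rho>. artanh (t / \<rho>) < artanh t + e) (at_left 1)"
    using assms by (intro order_tendstoD) auto
  moreover have "eventually (\<lambda>\<rho>. \<rho> \<in> {t<..<1}) (at_left 1)"
    using assms by (intro eventually_at_leftI[of t]) auto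
  ultimately have "eventually (\<lambda>\<rho>. t < \<rho> \<and> \<rho> < 1 \<and> artanh (t / \<rho>) < artanh t + e) (at_left 1)"
    by eventually_elim auto
  then obtain \<rho> where "t < \<rho> \<and> \<rho> < 1 \<and> artanh (t / \<rho>) < artanh t + e"
    using eventually_happens[of _ "at_left (1::real)"] trivial_limit_at_left_real by blast
  then show thesis using that by blast
qed

text \<open>Both sides vanish at 0, so comparing derivatives suffices. The error is a factor, hence
  sums over a chain to the same factor for any number of links; the lower bound needs this because
  its chains vary with \<open>n\<close>.\<close>

lemma artanh_divide_uniform:
  fixes T \<eta> :: real
  assumes T: "0 \<le> T" "T < 1" and \<eta>: "0 < \<eta>"
  obtains r where "T < r" "r < 1" "\<And>t. 0 \<le> t \<Longrightarrow> t \<le> T \<Longrightarrow> artanh (t / r) \<le> (1 + \<eta>) * artanh t"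
proof -
  \<comment> \<open>This makes \<open>(1 + \<eta>) * (r\<^sup>2 - s\<^sup>2) - (1 - s\<^sup>2) = \<eta> * (T\<^sup>2 - s\<^sup>2)\<close>, which compares the derivatives.\<close>
  define r where "r = sqrt ((1 + \<eta> * T\<^sup>2) / (1 + \<eta>))"
  have T2: "T\<^sup>2 < 1" using T by (simp add: abs_square_less_1)
  have r2: "r\<^sup>2 = (1 + \<eta> * T\<^sup>2) / (1 + \<eta>)" using \<eta> by (simp add: r_def)
  have r0: "0 < r" unfolding r_def using \<eta> by (intro real_sqrt_gt_zero divide_pos_pos add_pos_nonneg) auto
  have "r\<^sup>2 < 1\<^sup>2" using \<eta> T2 by (simp add: r2)
  then have r1: "r < 1" by (rule power2_less_imp_less) simp
  have "T\<^sup>2 < r\<^sup>2" using \<eta> T2 by (simp add: r2 field_simps)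
  then have rT: "T < r" using r0 by (intro power2_less_imp_less[of T r]) auto
  have "artanh (t / r) \<le> (1 + \<eta>) * artanh t" if t: "0 \<le> t" "t \<le> T" for t
  proof -
    define g where "g s = (1 + \<eta>) * artanh s - artanh (s / r)" for s
    have "g 0 \<le> g t"
    proof (rule DERIV_nonneg_imp_nondecreasing[OF t(1)])
      fix s assume s: "0 \<le> s" "s \<le> t"
      have sr: "s / r < 1" using s t rT r0 by (simp add: field_simps)
      have sr2: "s\<^sup>2 < r\<^sup>2" using s t rT by (intro power_strict_mono) auto
      have s2: "s\<^sup>2 < 1" using sr2 \<open>r\<^sup>2 < 1\<^sup>2\<close> by simp
      have "(g has_field_derivative ((1 + \<eta>) * (1 / (1 - s\<^sup>2)) - 1 / (1 - (s / r)\<^sup>2) * (1 / r))) (at s)"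
        unfolding g_def using s t T sr r0
        by (auto intro!: derivative_eq_intros DERIV_chain2[OF artanh_real_has_field_derivative])
      moreover have "1 / (1 - (s / r)\<^sup>2) * (1 / r) \<le> (1 + \<eta>) * (1 / (1 - s\<^sup>2))"
      proof -
        have "1 / (1 - (s / r)\<^sup>2) * (1 / r) = r / (r\<^sup>2 - s\<^sup>2)"
          using r0 sr2 by (simp add: field_simps power2_eq_square)
        also have "\<dots> \<le> 1 / (r\<^sup>2 - s\<^sup>2)" using r1 sr2 by (intro divide_right_mono) auto
        also have "\<dots> \<le> (1 + \<eta>) * (1 / (1 - s\<^sup>2))"
        proof -
          have "s\<^sup>2 \<le> T\<^sup>2" using s t by (intro power_mono) auto
          then have "\<eta> * s\<^sup>2 \<le> \<eta> * T\<^sup>2" using \<eta> by simp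
          moreover have "(1 + \<eta>) * r\<^sup>2 = 1 + \<eta> * T\<^sup>2" using \<eta> by (simp add: r2)
          ultimately have "1 - s\<^sup>2 \<le> (1 + \<eta>) * (r\<^sup>2 - s\<^sup>2)" by (simp add: algebra_simps)
          then show ?thesis using sr2 s2 by (simp add: divide_simps)
        qed
        finally show ?thesis .
      qed
      ultimately show "\<exists>y. (g has_field_derivative y) (at s) \<and> 0 \<le> y" by (intro exI conjI) auto
    qed
    then show ?thesis by (simp add: g_def)
  qed
  then show thesis using that rT r1 by blast
qed

subsection \<open>Bounding chains by half-planes\<close>

text \<open>A Cayley map takes the left half-plane to the unit disc and \<open>h 0\<close> to 0. The
  Schwarz lemma applies to the composition \<open>F\<close>, and the triangle inequality then
  isolates \<open>cmod (h \<xi>)\<close>.\<close>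

lemma half_plane_Schwarz:
  assumes h: "h holomorphic_on ball 0 1" and neg: "\<And>z. z \<in> ball 0 1 \<Longrightarrow> Re (h z) < 0"
    and \<xi>: "cmod \<xi> < 1"
  shows "cmod (h \<xi>) \<le> (1 + cmod \<xi>) / (1 - cmod \<xi>) * cmod (h 0)"
proof -
  \<comment> \<open>\<open>- cnj v\<close> is the mirror image of \<open>v\<close> in the imaginary
    axis, and \<open>u\<close> lies on the side of \<open>v\<close>.\<close>
  have lt: "cmod (u - v) < cmod (u + cnj v)" if "Re u < 0" "Re v < 0" for u v
  proof -
    have "(Re u - Re v)\<^sup>2 < (Re u + Re v)\<^sup>2"
      using mult_neg_neg[OF that] by (simp add: power2_sum power2_diff)
    then have "(cmod (u - v))\<^sup>2 < (cmod (u + cnj v))\<^sup>2" by (simp add: cmod_power2)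
    then show ?thesis by (rule power2_less_imp_less) simp
  qed
  have lt: "cmod (h z - h 0) < cmod (h z + cnj (h 0))" if "z \<in> ball 0 1" for z
    using lt neg that by simp
  have nz: "h z + cnj (h 0) \<noteq> 0" if "z \<in> ball 0 1" for z
    using lt[OF that] by (metis norm_not_less_zero norm_zero)
  define F where "F z = (h z - h 0) / (h z + cnj (h 0))" for z
  have "cmod (F \<xi>) \<le> cmod \<xi>"
  proof (rule Schwarz_Lemma)
    show "F holomorphic_on ball 0 1"
      unfolding F_def using h nz by (intro holomorphic_intros) auto
    show "cmod (F z) < 1" if "cmod z < 1" for z
      using lt[of z] nz[of z] that by (simp add: F_def norm_divide)
  qed (simp_all add: F_def \<xi>)
  then have "cmod (h \<xi> - h 0) \<le> cmod \<xi> * cmod (h \<xi> + cnj (h 0))"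
    using nz[of \<xi>] \<xi> by (simp add: F_def norm_divide field_simps)
  also have "\<dots> \<le> cmod \<xi> * (cmod (h \<xi>) + cmod (h 0))"
    by (metis complex_mod_cnj mult_left_mono norm_ge_zero norm_triangle_ineq)
  finally have "cmod (h \<xi>) - cmod (h 0) \<le> cmod \<xi> * (cmod (h \<xi>) + cmod (h 0))"
    using norm_triangle_ineq2[of "h \<xi>" "h 0"] by linarith
  then show ?thesis using \<xi> by (simp add: field_simps)
qed

text \<open>A link of parameter \<open>t\<close> multiplies the distance to \<open>\<beta>\<close>
  by at most \<open>(1 + t) / (1 - t) = exp (2 * artanh t)\<close>; along a chain these factors
  multiply to \<open>exp (2 * L)\<close>.\<close>

lemma disc_chain_half_plane:
  fixes c :: "complex ^ 'd"
  defines "l \<equiv> \<lambda>w. \<Sum>i\<in>UNIV. c $ i * w $ i"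
  assumes half: "\<And>w. w \<in> W \<Longrightarrow> Re (l w) < Re \<beta>" and "disc_chain W L x p"
  shows "cmod (l p - \<beta>) \<le> exp (2 * L) * cmod (l x - \<beta>)"
  using assms(3)
proof (induction rule: disc_chain.induct)
  case (step L x p f t q)
  have "(\<lambda>z. l (f z) - \<beta>) holomorphic_on ball 0 1"
    using step.hyps(2) unfolding l_def hol_disc_def by (intro holomorphic_intros) auto
  moreover have "Re (l (f z) - \<beta>) < 0" if "z \<in> ball 0 1" for z
    using half[of "f z"] step.hyps(2) that by (auto simp: hol_disc_def image_subset_iff)
  ultimately have "cmod (l (f (of_real t)) - \<beta>) \<le> (1 + t) / (1 - t) * cmod (l (f 0) - \<beta>)"
    using half_plane_Schwarz[of "\<lambda>z. l (f z) - \<beta>" "of_real t"] step.hyps by simp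
  also have "\<dots> \<le> (1 + t) / (1 - t) * (exp (2 * L) * cmod (l x - \<beta>))"
    using step by (intro mult_left_mono) auto
  also have "\<dots> = exp (2 * (L + artanh t)) * cmod (l x - \<beta>)"
    using step.hyps by (simp add: exp_twice_artanh[symmetric] distrib_left exp_add)
  finally show ?case using step.hyps by simp
qed simp

text \<open>A hyperplane separating \<open>W\<close> from \<open>x + z *s u\<close> gives a complex
  functional \<open>l\<close> mapping \<open>W\<close> into a half-plane. The chain controls
  \<open>r * cmod (l u)\<close> by the gap \<open>\<gamma>\<close>, which is at most
  \<open>cmod z * cmod (l u)\<close>, so \<open>l\<close> cancels.\<close>

lemma disc_chain_escape_bound:
  fixes W :: "(complex ^ 'd) set"
  assumes W: "open W" "convex W" "x \<in> W" and q: "x + z *s u \<notin> W"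
    and chain: "disc_chain W L x (x + of_real r *s u)" and r: "0 \<le> r"
  shows "r \<le> (1 + exp (2 * L)) * cmod z"
proof -
  define q where "q = x + z *s u"
  obtain a b where ab: "a \<noteq> 0" "\<forall>w\<in>W. a \<bullet> w \<le> b" "\<forall>w\<in>{q}. b \<le> a \<bullet> w"
    using separating_hyperplane_sets[of W "{q}"] W q by (auto simp: q_def)
  \<comment> \<open>Openness makes the separation strict: \<open>w\<close> can be pushed along
    \<open>a\<close> without leaving \<open>W\<close>.\<close>
  have strict: "a \<bullet> w < a \<bullet> q" if "w \<in> W" for w
  proof -
    obtain e where e: "e > 0" "cball w e \<subseteq> W"
      using W \<open>w \<in> W\<close> open_contains_cball by blast
    then have "w + (e / norm a) *\<^sub>R a \<in> W" using ab(1) by (auto simp: dist_norm)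
    then have "a \<bullet> w + (e / norm a) * (a \<bullet> a) \<le> a \<bullet> q"
      using ab by (auto simp: inner_add_right intro: order_trans)
    moreover have "(e / norm a) * (a \<bullet> a) > 0" using e ab(1) by simp
    ultimately show ?thesis by linarith
  qed
  \<comment> \<open>Conjugated coefficients make \<open>a \<bullet> w\<close> the real part of a
    complex linear functional.\<close>
  define c where "c = (\<chi> i. cnj (a $ i))"
  define l where "l = (\<lambda>w :: complex ^ 'd. \<Sum>i\<in>UNIV. c $ i * w $ i)"
  have Re_l: "Re (l w) = a \<bullet> w" for w
    by (simp add: l_def c_def inner_vec_def inner_complex_def Re_sum)
  have l_add: "l (x + s *s u) = l x + s * l u" for s
    by (simp add: l_def sum.distrib sum_distrib_left algebra_simps)
  define \<gamma> where "\<gamma> = Re (z * l u)"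
  have \<gamma>: "a \<bullet> q = a \<bullet> x + \<gamma>"
    using arg_cong[OF l_add[of z], of Re] Re_l by (simp add: q_def \<gamma>_def)
  have \<gamma>0: "\<gamma> > 0" using strict[OF W(3)] \<gamma> by simp
  have \<gamma>le: "\<gamma> \<le> cmod z * cmod (l u)"
    unfolding \<gamma>_def by (metis complex_Re_le_cmod norm_mult)
  then have lu: "cmod (l u) > 0" using \<gamma>0 by (cases "l u = 0") auto
  \<comment> \<open>The boundary point \<open>\<beta> = l x + \<gamma>\<close> has the real part of
    \<open>l q\<close> and lies at distance exactly \<open>\<gamma>\<close> from
    \<open>l x\<close>.\<close>
  have "cmod (l (x + of_real r *s u) - (l x + of_real \<gamma>)) \<le> exp (2 * L) * cmod (l x - (l x + of_real \<gamma>))"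
    unfolding l_def
    by (rule disc_chain_half_plane[OF _ chain]) (use strict \<gamma> Re_l in \<open>auto simp: l_def\<close>)
  then have "cmod (of_real r * l u - of_real \<gamma>) \<le> exp (2 * L) * \<gamma>"
    using \<gamma>0 by (simp add: l_add)
  then have "r * cmod (l u) \<le> (1 + exp (2 * L)) * \<gamma>"
    using norm_triangle_ineq2[of "of_real r * l u" "of_real \<gamma> :: complex"] r \<gamma>0
    by (simp add: norm_mult algebra_simps)
  also have "\<dots> \<le> (1 + exp (2 * L)) * (cmod z * cmod (l u))"
    using \<gamma>le by (intro mult_left_mono) (auto intro: add_nonneg_nonneg)
  finally show ?thesis using lu by (simp flip: mult.assoc)
qed

subsection \<open>Local Hausdorff convergence\<close>

lemma local_hausdorff_convD:
  assumes "local_hausdorff_conv V W" "e > 0"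
  shows "eventually (\<lambda>n. \<forall>w\<in>closure (V n). norm w \<le> R \<longrightarrow> (\<exists>y\<in>closure W. dist y w \<le> e)) sequentially"
    and "eventually (\<lambda>n. \<forall>w\<in>closure W. norm w \<le> R \<longrightarrow> (\<exists>y\<in>closure (V n). dist y w \<le> e)) sequentially"
proof -
  \<comment> \<open>\<open>max R 1\<close> meets the positivity demanded by the definition, so
    \<open>R\<close> may be any real.\<close>
  have ev: "eventually (\<lambda>n. hausdorff_le (closure (V n) \<inter> cball 0 (max R 1)) (closure W \<inter> cball 0 (max R 1)) e) sequentially"
    using assms unfolding local_hausdorff_conv_def by simp
  show "eventually (\<lambda>n. \<forall>w\<in>closure (V n). norm w \<le> R \<longrightarrow> (\<exists>y\<in>closure W. dist y w \<le> e)) sequentially"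
    using ev by eventually_elim (fastforce simp: hausdorff_le_def)
  show "eventually (\<lambda>n. \<forall>w\<in>closure W. norm w \<le> R \<longrightarrow> (\<exists>y\<in>closure (V n). dist y w \<le> e)) sequentially"
    using ev by eventually_elim (fastforce simp: hausdorff_le_def)
qed

lemma local_hausdorff_conv_avoid_ball:
  assumes "local_hausdorff_conv V W" "q \<notin> closure W"
  obtains e where "e > 0" "eventually (\<lambda>n. ball q e \<inter> V n = {}) sequentially"
proof -
  obtain e where e: "e > 0" "ball q e \<subseteq> - closure W"
    using assms(2) open_contains_ball[of "- closure W"] by auto
  have "eventually (\<lambda>n. \<forall>w\<in>closure (V n). norm w \<le> norm q + e \<longrightarrow> (\<exists>y\<in>closure W. dist y w \<le> e / 2)) sequentially"
    using e by (intro local_hausdorff_convD[OF assms(1)]) auto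
  then have "eventually (\<lambda>n. ball q (e / 2) \<inter> V n = {}) sequentially"
  proof eventually_elim
    case (elim n)
    show ?case
    proof (rule equals0I)
      fix w assume w: "w \<in> ball q (e / 2) \<inter> V n"
      then have "norm w \<le> norm q + e"
        using norm_triangle_ineq4[of q "q - w"] e(1) by (simp add: dist_norm)
      then obtain y where y: "y \<in> closure W" "dist y w \<le> e / 2"
        using elim w closure_subset by blast
      then have "y \<in> ball q e" using w dist_triangle[of q y w] by (simp add: dist_commute)
      then show False using y e by blast
    qed
  qed
  then show thesis using that[of "e / 2"] e by simp
qed

text \<open>Convexity excludes holes: if \<open>V n\<close> missed a point \<open>p\<close> of
  \<open>K\<close>, it would lie on one side of a hyperplane, far from some point of
  \<open>W\<close> beyond \<open>p\<close>.\<close>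

lemma local_hausdorff_conv_compact_subset:
  fixes V :: "nat \<Rightarrow> (complex ^ 'd) set"
  assumes conv: "local_hausdorff_conv V W" and V: "\<And>n. convex (V n)" "\<And>n. open (V n)"
    and W: "open W" and K: "compact K" "K \<subseteq> W"
  shows "eventually (\<lambda>n. K \<subseteq> V n) sequentially"
proof -
  obtain s where s: "s > 0" "(\<Union>p\<in>K. cball p s) \<subseteq> W"
    using compact_subset_open_imp_cball_epsilon_subset[OF K(1) W K(2)] by blast
  obtain B where B: "\<And>p. p \<in> K \<Longrightarrow> norm p \<le> B"
    using compact_imp_bounded[OF K(1)] bounded_iff by blast
  have "eventually (\<lambda>n. \<forall>w\<in>closure W. norm w \<le> B + s \<longrightarrow> (\<exists>y\<in>closure (V n). dist y w \<le> s / 2)) sequentially"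
    using s by (intro local_hausdorff_convD[OF conv]) auto
  then show ?thesis
  proof eventually_elim
    case (elim n)
    show ?case
    proof (rule subsetI, rule ccontr)
      fix p assume p: "p \<in> K" "p \<notin> V n"
      have ne: "closure (V n) \<noteq> {}"
        using elim B p s K closure_subset[of W] by (smt (verit) empty_iff subsetD)
      obtain a b where ab: "a \<noteq> 0" "\<forall>w\<in>V n. a \<bullet> w \<le> b" "\<forall>w\<in>{p}. b \<le> a \<bullet> w"
        using separating_hyperplane_sets[of "V n" "{p}"] V ne p by auto
      have cl: "a \<bullet> w \<le> b" if "w \<in> closure (V n)" for w
        using that ab(2) closure_minimal[of "V n" "{w. a \<bullet> w \<le> b}"] closed_halfspace_le by blast
      \<comment> \<open>Going \<open>s\<close> along the normal stays in \<open>W\<close> but ends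
        at distance at least \<open>s\<close> from \<open>closure (V n)\<close>, against the
        approximation within \<open>s / 2\<close>.\<close>
      define w where "w = p + (s / norm a) *\<^sub>R a"
      have nw: "norm (w - p) = s" using s ab(1) by (simp add: w_def)
      then have "w \<in> cball p s" by (simp add: dist_norm norm_minus_commute)
      then have "w \<in> W" using s p by blast
      moreover have "norm w \<le> B + s"
        using B[OF p(1)] norm_triangle_ineq[of p "w - p"] nw by simp
      ultimately obtain y where y: "y \<in> closure (V n)" "dist y w \<le> s / 2"
        using elim closure_subset by blast
      have "a \<bullet> w = a \<bullet> p + s * norm a"
        using ab(1) by (simp add: w_def inner_add_right dot_square_norm power2_eq_square)
      moreover have "a \<bullet> (w - y) \<le> norm a * (s / 2)"
        using norm_cauchy_schwarz[of a "w - y"] y(2)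
        by (smt (verit, best) dist_commute dist_norm mult_left_mono norm_ge_zero)
      moreover have "a \<bullet> y \<le> a \<bullet> p" using cl[OF y(1)] ab(3) by auto
      ultimately have "s * norm a \<le> norm a * (s / 2)" by (simp add: inner_diff_right)
      then show False using s ab(1) by simp
    qed
  qed
qed

text \<open>With \<open>y\<close> in \<open>closure W\<close> near \<open>w\<close>, the shrunken
  point is the convex combination of \<open>y\<close> (weight \<open>\<mu>\<close>) and a point
  \<open>c\<close> near \<open>x\<close> that absorbs the error \<open>w - y\<close>.\<close>

lemma local_hausdorff_conv_shrink:
  fixes V :: "nat \<Rightarrow> (complex ^ 'd) set"
  assumes conv: "local_hausdorff_conv V W" and W: "open W" "convex W" "x \<in> W"
    and \<mu>: "0 < \<mu>" "\<mu> < 1"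
  shows "eventually (\<lambda>n. \<forall>w\<in>V n. norm w \<le> R \<longrightarrow> x + \<mu> *\<^sub>R (w - x) \<in> W) sequentially"
proof -
  obtain s where s: "s > 0" "cball x s \<subseteq> W" using W open_contains_cball by blast
  \<comment> \<open>Chosen so that \<open>\<mu> / (1 - \<mu>) * e = s\<close>, the displacement of
    \<open>c\<close> from \<open>x\<close> that is allowed.\<close>
  define e where "e = s * (1 - \<mu>) / \<mu>"
  have e: "e > 0" using s \<mu> by (simp add: e_def)
  have "eventually (\<lambda>n. \<forall>w\<in>closure (V n). norm w \<le> R \<longrightarrow> (\<exists>y\<in>closure W. dist y w \<le> e)) sequentially"
    using e by (intro local_hausdorff_convD[OF conv])
  then show ?thesis
  proof eventually_elim
    case (elim n)
    show ?case
    proof (intro ballI impI)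
      fix w assume w: "w \<in> V n" "norm w \<le> R"
      then obtain y where y: "y \<in> closure W" "dist y w \<le> e"
        using elim closure_subset by blast
      define c where "c = x + (\<mu> / (1 - \<mu>)) *\<^sub>R (w - y)"
      have "dist x c = \<mu> / (1 - \<mu>) * dist y w"
        using \<mu> by (simp add: c_def dist_norm norm_minus_commute)
      also have "\<dots> \<le> \<mu> / (1 - \<mu>) * e" using y \<mu> by (intro mult_left_mono) auto
      also have "\<dots> = s" using \<mu> by (simp add: e_def)
      finally have "c \<in> interior W" using s W by (auto simp: interior_open)
      then have "y - (1 - \<mu>) *\<^sub>R (y - c) \<in> interior W"
        using mem_interior_closure_convex_shrink[OF W(2) _ y(1), of c "1 - \<mu>"] \<mu> by simp
      moreover have "y - (1 - \<mu>) *\<^sub>R (y - c) = x + \<mu> *\<^sub>R (w - x)"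
      proof -
        have "(1 - \<mu>) *\<^sub>R c = (1 - \<mu>) *\<^sub>R x + \<mu> *\<^sub>R (w - y)"
          using \<mu> by (simp add: c_def scaleR_add_right)
        then show ?thesis by (simp add: algebra_simps)
      qed
      ultimately show "x + \<mu> *\<^sub>R (w - x) \<in> W" using interior_subset by auto
    qed
  qed
qed

text \<open>Doubling the parameter of a point outside \<open>W\<close> leads out of the closure:
  otherwise the midpoint with the interior point \<open>x\<close> would lie in \<open>W\<close>.
  Avoiding the closure is what passes to the approximating domains.\<close>

lemma C_proper_escape:
  fixes W :: "(complex ^ 'd) set"
  assumes "open W" "convex W" "C_proper W" "x \<in> W" "v \<noteq> 0"
  obtains z where "x + z *s v \<notin> closure W"
proof -
  obtain z where z: "x + z *s v \<notin> W"
    using assms(3,5) unfolding C_proper_def by blast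
  have "x + (2 * z) *s v \<notin> closure W"
  proof
    assume cl: "x + (2 * z) *s v \<in> closure W"
    have "x \<in> interior W" using assms by (simp add: interior_open)
    from mem_interior_closure_convex_shrink[OF assms(2) this cl, of "1 / 2"]
    have "x + (2 * z) *s v - (1 / 2) *\<^sub>R (x + (2 * z) *s v - x) \<in> W"
      using interior_subset by auto
    moreover have "x + (2 * z) *s v - (1 / 2) *\<^sub>R (x + (2 * z) *s v - x) = x + z *s v"
      by (simp add: vec_eq_iff scaleR_conv_of_real[where 'a = complex])
    ultimately show False using z by metis
  qed
  then show thesis using that by blast
qed

text \<open>One \<open>z\<close> leads out of \<open>V n\<close> for all large \<open>n\<close> and
  all directions near a given one; compactness of the sphere leaves finitely many such
  \<open>z\<close>.\<close>

lemma local_hausdorff_conv_uniform_escape: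
  fixes V :: "nat \<Rightarrow> (complex ^ 'd) set"
  assumes conv: "local_hausdorff_conv V W" and W: "open W" "convex W" "C_proper W" "x \<in> W"
  obtains M where "eventually (\<lambda>n. \<forall>u\<in>sphere 0 1. \<exists>z. cmod z \<le> M \<and> x + z *s u \<notin> V n) sequentially"
proof -
  have "\<exists>T z. open T \<and> v \<in> T \<and> eventually (\<lambda>n. \<forall>u\<in>T. x + z *s u \<notin> V n) sequentially"
    if "v \<in> sphere 0 1" for v :: "complex ^ 'd"
  proof -
    have "v \<noteq> 0" using that by auto
    obtain z where z: "x + z *s v \<notin> closure W" using C_proper_escape[OF W \<open>v \<noteq> 0\<close>] by blast
    obtain e where e: "e > 0" "eventually (\<lambda>n. ball (x + z *s v) e \<inter> V n = {}) sequentially"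
      using local_hausdorff_conv_avoid_ball[OF conv z] by blast
    have near: "x + z *s u \<in> ball (x + z *s v) e" if "u \<in> ball v (e / (cmod z + 1))" for u
    proof -
      have "dist (x + z *s v) (x + z *s u) = cmod z * dist v u"
        by (simp add: dist_norm vector_ssub_ldistrib[symmetric] norm_vector_scalar_mult
            del: vector_ssub_ldistrib)
      also have "\<dots> \<le> (cmod z + 1) * dist v u" by (intro mult_right_mono) auto
      also have "\<dots> < e"
        using that by (simp add: pos_less_divide_eq add_nonneg_pos mult.commute)
      finally show ?thesis by simp
    qed
    have "eventually (\<lambda>n. \<forall>u\<in>ball v (e / (cmod z + 1)). x + z *s u \<notin> V n) sequentially"
      using e(2) by eventually_elim (use near in blast)
    moreover have "v \<in> ball v (e / (cmod z + 1))" using e by (simp add: add_nonneg_pos)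
    ultimately show ?thesis by (intro exI[of _ "ball v (e / (cmod z + 1))"] exI[of _ z]) auto
  qed
  then have "\<forall>v\<in>sphere 0 1. \<exists>T z. open T \<and> v \<in> T \<and>
      eventually (\<lambda>n. \<forall>u\<in>T. x + z *s u \<notin> V n) sequentially"
    by blast
  from this[unfolded bchoice_iff] obtain T Z where
    "\<forall>v\<in>sphere 0 1. open (T v) \<and> v \<in> T v \<and>
      eventually (\<lambda>n. \<forall>u\<in>T v. x + Z v *s u \<notin> V n) sequentially"
    by (elim exE)
  then have T: "open (T v)" "v \<in> T v" "eventually (\<lambda>n. \<forall>u\<in>T v. x + Z v *s u \<notin> V n) sequentially"
    if "v \<in> sphere 0 1" for v
    using that by blast+
  have "compact (sphere (0 :: complex ^ 'd) 1)" by simp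
  then obtain F where F: "F \<subseteq> sphere 0 1" "finite F" "sphere 0 1 \<subseteq> (\<Union>v\<in>F. T v)"
    by (rule compactE_image[of _ "sphere 0 1" T]) (use T in auto)
  have "eventually (\<lambda>n. \<forall>v\<in>F. \<forall>u\<in>T v. x + Z v *s u \<notin> V n) sequentially"
    using F T by (intro eventually_ball_finite) auto
  then have "eventually (\<lambda>n. \<forall>u\<in>sphere 0 1. \<exists>z. cmod z \<le> (\<Sum>v\<in>F. cmod (Z v)) \<and> x + z *s u \<notin> V n) sequentially"
  proof eventually_elim
    case (elim n)
    show ?case
    proof
      fix u :: "complex ^ 'd" assume "u \<in> sphere 0 1"
      then obtain v where v: "v \<in> F" "u \<in> T v" using F by blast
      then have "cmod (Z v) \<le> (\<Sum>v\<in>F. cmod (Z v))" using F by (intro member_le_sum) auto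
      then show "\<exists>z. cmod z \<le> (\<Sum>v\<in>F. cmod (Z v)) \<and> x + z *s u \<notin> V n" using elim v by blast
    qed
  qed
  then show thesis using that by blast
qed

subsection \<open>Convergence of the Kobayashi distances\<close>

text \<open>Only the shrunken disc has to lie in \<open>W\<close>; in the lower bound the full disc
  may leave it.\<close>

lemma hol_disc_rescale:
  fixes f :: "complex \<Rightarrow> complex ^ 'd"
  assumes "\<And>i. (\<lambda>z. f z $ i) holomorphic_on ball 0 1" "0 < \<rho>" "\<rho> \<le> 1"
    and "\<And>z. cmod z < 1 \<Longrightarrow> f (of_real \<rho> * z) \<in> W"
  shows "hol_disc W (\<lambda>z. f (of_real \<rho> * z))"
proof -
  have lt: "cmod (of_real \<rho> * z) < 1" if "cmod z < 1" for z
    using that assms(2,3) mult_le_one[of \<rho> "cmod z"] mult_left_le_one_le[of "cmod z" \<rho>]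
    by (simp add: norm_mult)
  have "hol_disc UNIV (f \<circ> (\<lambda>z. of_real \<rho> * z))"
    using assms(1) lt by (intro hol_disc_compose) (auto simp: hol_disc_def intro!: holomorphic_intros)
  then show ?thesis using assms(4) by (auto simp: hol_disc_def)
qed

text \<open>Shrinking by \<open>\<rho>\<close> moves the end parameter from \<open>t\<close> to
  \<open>t / \<rho>\<close>, so the joints of the chain stay put. Half of \<open>e\<close> pays for
  the last link and half for the rest, hence the induction over arbitrary \<open>e\<close>.\<close>

lemma disc_chain_eventually:
  fixes V :: "nat \<Rightarrow> (complex ^ 'd) set"
  assumes conv: "local_hausdorff_conv V W" and V: "\<And>n. convex (V n)" "\<And>n. open (V n)"
    and W: "open W" and chain: "disc_chain W L x y" and "0 < e"
  shows "eventually (\<lambda>n. \<exists>L'\<le>L + e. disc_chain (V n) L' x y) sequentially"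
  using chain \<open>0 < e\<close>
proof (induction arbitrary: e rule: disc_chain.induct)
  case (refl x)
  then show ?case by (intro always_eventually allI exI[of _ 0]) (auto intro: disc_chain.refl)
next
  case (step L x p f t q)
  obtain \<rho> where \<rho>: "t < \<rho>" "\<rho> < 1" "artanh (t / \<rho>) < artanh t + e / 2"
    using artanh_divide_near[OF step.hyps(4,5), of "e / 2"] step.prems by auto
  have \<rho>0: "0 < \<rho>" using \<rho> step.hyps by linarith
  have "continuous_on (ball 0 1) (\<lambda>z. \<chi> i. f z $ i)"
    using step.hyps(2) unfolding hol_disc_def
    by (intro continuous_on_vec_lambda holomorphic_on_imp_continuous_on) auto
  then have "continuous_on (cball 0 \<rho>) f"
    using continuous_on_subset[of "ball 0 1" f "cball 0 \<rho>"] \<rho> by (simp add: subset_iff)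
  then have "compact (f ` cball 0 \<rho>)" by (intro compact_continuous_image) auto
  moreover have "f ` cball 0 \<rho> \<subseteq> W"
    using step.hyps(2) \<rho> unfolding hol_disc_def by fastforce
  ultimately have "eventually (\<lambda>n. f ` cball 0 \<rho> \<subseteq> V n) sequentially"
    by (rule local_hausdorff_conv_compact_subset[OF conv V W])
  moreover have "eventually (\<lambda>n. \<exists>L'\<le>L + e / 2. disc_chain (V n) L' x p) sequentially"
    using step.prems by (intro step.IH) auto
  ultimately show ?case
  proof eventually_elim
    case (elim n)
    obtain L' where L': "L' \<le> L + e / 2" "disc_chain (V n) L' x p" using elim by blast
    have "of_real \<rho> * z \<in> cball 0 \<rho>" if "cmod z < 1" for z
      using that \<rho>0 mult_left_le[of "cmod z" \<rho>] by (simp add: norm_mult)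
    then have "hol_disc (V n) (\<lambda>z. f (of_real \<rho> * z))"
      using step.hyps(2) \<rho> \<rho>0 elim by (intro hol_disc_rescale) (auto simp: hol_disc_def)
    then have "disc_chain (V n) (L' + artanh (t / \<rho>)) x q"
      using \<rho> \<rho>0 step.hyps by (intro disc_chain.step[OF L'(2), of "\<lambda>z. f (of_real \<rho> * z)"]) auto
    then show ?case using L'(1) \<rho>(3) by (intro exI[of _ "L' + artanh (t / \<rho>)"]) auto
  qed
qed

text \<open>The escape bound in the direction from \<open>x\<close> to \<open>p\<close>. It depends
  on \<open>V\<close> only through \<open>M\<close>, hence is uniform along the sequence.\<close>

lemma disc_chain_bounded:
  fixes V :: "(complex ^ 'd) set"
  assumes V: "open V" "convex V" "x \<in> V"
    and escape: "\<And>u. u \<in> sphere 0 1 \<Longrightarrow> \<exists>z. cmod z \<le> M \<and> x + z *s u \<notin> V"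
    and chain: "disc_chain V L x p" and LC: "L \<le> C" and M: "0 \<le> M"
  shows "norm p \<le> norm x + (1 + exp (2 * C)) * M"
proof (cases "p = x")
  case True
  then show ?thesis using M by (auto intro!: mult_nonneg_nonneg add_nonneg_nonneg)
next
  case False
  define u where "u = sgn (p - x)"
  have "u \<in> sphere 0 1" using False by (simp add: u_def norm_sgn)
  then obtain z where z: "cmod z \<le> M" "x + z *s u \<notin> V" using escape by blast
  have "p = x + of_real (norm (p - x)) *s u"
    using False by (simp add: u_def sgn_div_norm vec_eq_iff scaleR_conv_of_real[where 'a = complex] field_simps)
  then have "norm (p - x) \<le> (1 + exp (2 * L)) * cmod z"
    using disc_chain_escape_bound[OF V z(2), of L "norm (p - x)"] chain by simp
  also have "\<dots> \<le> (1 + exp (2 * C)) * M"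
    using z LC by (intro mult_mono) (auto intro: add_nonneg_nonneg)
  finally show ?thesis using norm_triangle_ineq2[of p x] by linarith
qed

text \<open>Each link \<open>f\<close> is shrunk by \<open>r\<close>, followed by the homothety
  about \<open>x\<close>, and given end parameter \<open>t / r\<close>. The points
  \<open>f (r * z)\<close> are reached from \<open>x\<close> by chains of length at most
  \<open>D + artanh r\<close>, so they lie in the ball where the homothety maps \<open>V\<close>
  into \<open>W\<close>.\<close>

lemma disc_chain_shrink:
  fixes V W :: "(complex ^ 'd) set"
  assumes V: "open V" "convex V" "x \<in> V"
    and escape: "\<And>u. u \<in> sphere 0 1 \<Longrightarrow> \<exists>z. cmod z \<le> M \<and> x + z *s u \<notin> V" "0 \<le> M"
    and T: "\<And>t. 0 \<le> t \<Longrightarrow> t < 1 \<Longrightarrow> artanh t \<le> D \<Longrightarrow> t \<le> T"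
    and r: "0 < r" "T < r" "r < 1"
      "\<And>t. 0 \<le> t \<Longrightarrow> t \<le> T \<Longrightarrow> artanh (t / r) \<le> (1 + \<eta>) * artanh t"
    and S: "\<And>w. w \<in> V \<Longrightarrow> norm w \<le> norm x + (1 + exp (2 * (D + artanh r))) * M \<Longrightarrow>
      x + \<mu> *\<^sub>R (w - x) \<in> W"
    and chain: "disc_chain V L x y" and "L \<le> D"
  shows "\<exists>L'\<le>(1 + \<eta>) * L. disc_chain W L' x (x + \<mu> *\<^sub>R (y - x))"
  using chain V(3) escape S \<open>L \<le> D\<close>
proof (induction rule: disc_chain.induct)
  case (refl x)
  then show ?case by (auto intro: exI[of _ 0] disc_chain.refl)
next
  case (step L x p f t q)
  define S where "S w = x + \<mu> *\<^sub>R (w - x)" for w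
  have at: "0 \<le> artanh t" using step.hyps by (intro artanh_nonneg_real)
  have L0: "0 \<le> L" using step.hyps(1) by (rule disc_chain_nonneg)
  have tT: "t \<le> T" using step.hyps step.prems L0 by (intro T) auto
  have "\<exists>L'\<le>(1 + \<eta>) * L. disc_chain W L' x (x + \<mu> *\<^sub>R (p - x))"
    using step.prems at by (intro step.IH) auto
  then obtain L' where L': "L' \<le> (1 + \<eta>) * L" "disc_chain W L' x (S p)"
    unfolding S_def by blast
  have inW: "S (f (of_real r * z)) \<in> W" if "cmod z < 1" for z
  proof -
    have rz: "cmod (of_real r * z) \<le> r" using that r(1) mult_left_le[of "cmod z" r] by (simp add: norm_mult)
    then have rz1: "cmod (of_real r * z) < 1" using r(3) by linarith
    then have fV: "f (of_real r * z) \<in> V"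
      using step.hyps(2) by (auto simp: hol_disc_def)
    \<comment> \<open>Ending the last link at \<open>f (r * z)\<close> instead of \<open>q\<close>
      costs \<open>artanh s\<close>, at most \<open>artanh r\<close>.\<close>
    obtain g s where g: "hol_disc V g" "g 0 = f 0" "0 \<le> s" "s < 1" "g (of_real s) = f (of_real r * z)"
      "artanh s = poincare_dist 0 (of_real r * z)"
      using hol_disc_normalise[OF step.hyps(2), of 0 "of_real r * z"] rz1 by auto
    have "artanh s \<le> artanh r"
      using rz r artanh_mono_real[of "cmod (of_real r * z)" r] by (simp add: g poincare_dist_def)
    moreover have "disc_chain V (L + artanh s) x (f (of_real r * z))"
      by (rule disc_chain.step[OF step.hyps(1) g(1) _ g(3-5)]) (use g step.hyps in simp)
    moreover have "L \<le> D" using step.prems at by linarith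
    ultimately have "norm (f (of_real r * z)) \<le> norm x + (1 + exp (2 * (D + artanh r))) * M"
      using disc_chain_bounded[OF V(1,2) step.prems(1,2), of "L + artanh s" _ "D + artanh r"] step.prems(3) by simp
    then show ?thesis using step.prems(4)[OF fV] by (simp add: S_def)
  qed
  have holS: "(\<lambda>z. S (f z) $ i) holomorphic_on ball 0 1" for i
    using step.hyps(2) unfolding S_def hol_disc_def
    by (auto simp: scaleR_conv_of_real[where 'a = complex] intro!: holomorphic_intros)
  have "hol_disc W (\<lambda>z. S (f (of_real r * z)))"
    using holS r inW by (intro hol_disc_rescale) auto
  then have "disc_chain W (L' + artanh (t / r)) x (S q)"
    using r step.hyps tT by (intro disc_chain.step[OF L'(2), of "\<lambda>z. S (f (of_real r * z))"]) auto
  moreover have "L' + artanh (t / r) \<le> (1 + \<eta>) * (L + artanh t)"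
    using L'(1) r(4)[OF step.hyps(4) tT] by (simp add: distrib_left)
  ultimately show ?case unfolding S_def by blast
qed

text \<open>A single affine disc joins \<open>w\<close> to \<open>y\<close>. This absorbs the
  displacement of the endpoint \<open>y\<close> by the homothety.\<close>

lemma kobayashi_dist_small:
  fixes W :: "(complex ^ 'd) set"
  assumes "open W" "y \<in> W" "0 < e"
  obtains d where "d > 0" "\<And>w. dist w y < d \<Longrightarrow> w \<in> W \<and> kobayashi_dist W w y < e"
proof -
  obtain s where s: "s > 0" "ball y s \<subseteq> W" using assms open_contains_ball by blast
  obtain \<rho> where \<rho>: "0 < \<rho>" "\<rho> < 1" "artanh \<rho> < e"
  proof -
    have "(artanh \<longlongrightarrow> artanh 0) (at_right (0::real))"
      using isCont_artanh[of 0] by (simp add: isCont_def filterlim_at_split)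
    then have "eventually (\<lambda>\<rho>. artanh \<rho> < e) (at_right (0::real))"
      using assms(3) by (intro order_tendstoD) auto
    moreover have "eventually (\<lambda>\<rho>. \<rho> \<in> {0<..<1}) (at_right (0::real))"
      by (rule eventually_at_rightI) auto
    ultimately have "eventually (\<lambda>\<rho>. 0 < \<rho> \<and> \<rho> < 1 \<and> artanh \<rho> < e) (at_right 0)"
      by eventually_elim auto
    then show thesis
      using that eventually_happens[of _ "at_right (0::real)"] trivial_limit_at_right_real by blast
  qed
  \<comment> \<open>The ball of radius \<open>s / 2\<close> about \<open>w\<close> then stays in
    \<open>ball y s\<close>, and the link parameter \<open>dist w y / (s / 2)\<close> is below
    \<open>\<rho>\<close>.\<close>
  define d where "d = s / 2 * \<rho>"
  show thesis
  proof (rule that)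
    show "d > 0" using s \<rho> by (simp add: d_def)
    fix w assume w: "dist w y < d"
    have "d \<le> s / 2" using s \<rho> by (simp add: d_def mult_left_le)
    then have ws: "dist w y < s / 2" using w by linarith
    have ball: "ball w (s / 2) \<subseteq> ball y s"
    proof
      fix u assume "u \<in> ball w (s / 2)"
      then show "u \<in> ball y s" using ws dist_triangle[of y u w] by (simp add: dist_commute)
    qed
    have "w \<in> W" using ws s ball by (auto simp: dist_commute)
    moreover have "kobayashi_dist W w y \<le> artanh (dist w y / (s / 2))"
      using ball s ws by (intro kobayashi_dist_le disc_chain_short) auto
    moreover have "artanh (dist w y / (s / 2)) \<le> artanh \<rho>"
      using w s \<rho> by (intro artanh_mono_real) (auto simp: d_def field_simps)
    ultimately show "w \<in> W \<and> kobayashi_dist W w y < e" using \<rho>(3) by linarith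
  qed
qed

lemma kobayashi_dist_tendsto:
  fixes V :: "nat \<Rightarrow> (complex ^ 'd) set"
  assumes conv: "local_hausdorff_conv V W" and V: "\<And>n. open (V n)" "\<And>n. convex (V n)"
    and W: "open W" "convex W" "C_proper W" and xy: "x \<in> W" "y \<in> W"
  shows "(\<lambda>n. kobayashi_dist (V n) x y) \<longlonglongrightarrow> kobayashi_dist W x y"
proof -
  have upper: "eventually (\<lambda>n. kobayashi_dist (V n) x y < kobayashi_dist W x y + e) sequentially"
    if "e > 0" for e
  proof -
    obtain L where L: "disc_chain W L x y" "L < kobayashi_dist W x y + e / 2"
      using disc_chain_near_kobayashi_dist[OF W(1,2) xy, of "kobayashi_dist W x y + e / 2"] \<open>e > 0\<close> by auto
    have "eventually (\<lambda>n. \<exists>L'\<le>L + e / 2. disc_chain (V n) L' x y) sequentially"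
      using \<open>e > 0\<close> by (intro disc_chain_eventually[OF conv V(2,1) W(1) L(1)]) auto
    then show ?thesis
      by eventually_elim (use L(2) kobayashi_dist_le in fastforce)
  qed
  have lower: "eventually (\<lambda>n. kobayashi_dist W x y < kobayashi_dist (V n) x y + e) sequentially"
    if "e > 0" for e
  proof -
    obtain M where M: "eventually (\<lambda>n. \<forall>u\<in>sphere 0 1. \<exists>z. cmod z \<le> M \<and> x + z *s u \<notin> V n) sequentially"
      using local_hausdorff_conv_uniform_escape[OF conv W xy(1)] by blast
    \<comment> \<open>\<open>D\<close> bounds near-optimal chains in \<open>V n\<close> for large
      \<open>n\<close>: the upper bound with error 1, plus a slack of \<open>e / 4\<close>.\<close>
    define D where "D = kobayashi_dist W x y + 1 + e / 4"
    define T where "T = (exp (2 * D) - 1) / (exp (2 * D) + 1)"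
    \<comment> \<open>Error budget: \<open>e / 4\<close> each for the slack of the chain, for the
      factor \<open>1 + \<eta>\<close> on lengths up to \<open>D\<close>, and for the moved
      endpoint.\<close>
    define \<eta> where "\<eta> = e / 4 / (D + 1)"
    have "0 \<le> kobayashi_dist W x y"
      unfolding kobayashi_dist_eq_Inf_disc_chain using disc_chain_exists[OF W(1,2) xy]
      by (intro cInf_greatest) (auto dest: disc_chain_nonneg)
    then have D: "D > 0" using \<open>e > 0\<close> by (simp add: D_def)
    have \<eta>: "\<eta> > 0" "\<eta> * D \<le> e / 4" using D \<open>e > 0\<close> by (auto simp: \<eta>_def field_simps)
    have T: "0 \<le> T" "T < 1" using D by (auto simp: T_def field_simps add_pos_pos)
    obtain r where r: "T < r" "r < 1" "\<And>t. 0 \<le> t \<Longrightarrow> t \<le> T \<Longrightarrow> artanh (t / r) \<le> (1 + \<eta>) * artanh t"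
      using artanh_divide_uniform[OF T \<eta>(1)] by blast
    obtain d where d: "d > 0" "\<And>w. dist w y < d \<Longrightarrow> w \<in> W \<and> kobayashi_dist W w y < e / 4"
      using kobayashi_dist_small[OF W(1) xy(2), of "e / 4"] \<open>e > 0\<close> by auto
    have "((\<lambda>\<mu>. x + \<mu> *\<^sub>R (y - x)) \<longlongrightarrow> x + 1 *\<^sub>R (y - x)) (at_left 1)"
      by (intro tendsto_intros)
    then have "eventually (\<lambda>\<mu>. dist (x + \<mu> *\<^sub>R (y - x)) y < d) (at_left 1)"
      using d(1) by (auto dest: tendstoD)
    moreover have "eventually (\<lambda>\<mu>. \<mu> \<in> {0<..<1::real}) (at_left 1)"
      by (rule eventually_at_leftI) auto
    ultimately have "eventually (\<lambda>\<mu>. 0 < \<mu> \<and> \<mu> < 1 \<and> dist (x + \<mu> *\<^sub>R (y - x)) y < d) (at_left 1)"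
      by eventually_elim auto
    then obtain \<mu> where \<mu>: "0 < \<mu>" "\<mu> < 1" "dist (x + \<mu> *\<^sub>R (y - x)) y < d"
      using eventually_happens[of _ "at_left (1::real)"] trivial_limit_at_left_real by blast
    \<comment> \<open>The sign of \<open>M\<close> is not recorded, while the bound on chains asks
      for a nonnegative constant.\<close>
    define R where "R = norm x + (1 + exp (2 * (D + artanh r))) * max M 0"
    have "eventually (\<lambda>n. \<forall>w\<in>V n. norm w \<le> R \<longrightarrow> x + \<mu> *\<^sub>R (w - x) \<in> W) sequentially"
      by (rule local_hausdorff_conv_shrink[OF conv W(1,2) xy(1) \<mu>(1,2)])
    moreover have "eventually (\<lambda>n. {x, y} \<subseteq> V n) sequentially"
      using xy by (intro local_hausdorff_conv_compact_subset[OF conv V(2,1) W(1)]) auto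
    moreover have "eventually (\<lambda>n. kobayashi_dist (V n) x y < kobayashi_dist W x y + 1) sequentially"
      by (rule upper) simp
    ultimately show ?thesis using M
    proof eventually_elim
      case (elim n)
      obtain L where L: "disc_chain (V n) L x y" "L < kobayashi_dist (V n) x y + e / 4"
        using disc_chain_near_kobayashi_dist[OF V, of x n y "kobayashi_dist (V n) x y + e / 4"] \<open>e > 0\<close> elim
        by auto
      have LD: "L \<le> D" using L(2) elim by (simp add: D_def)
      have "\<exists>L'\<le>(1 + \<eta>) * L. disc_chain W L' x (x + \<mu> *\<^sub>R (y - x))"
      proof (rule disc_chain_shrink[OF V _ _ _ _ _ r(1,2,3) _ L(1) LD])
        show "x \<in> V n" using elim by simp
        show "\<exists>z. cmod z \<le> max M 0 \<and> x + z *s u \<notin> V n" if "u \<in> sphere 0 1" for u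
          using elim that by fastforce
        show "0 \<le> max M 0" by simp
        show "t \<le> T" if "0 \<le> t" "t < 1" "artanh t \<le> D" for t
          unfolding T_def using that by (rule artanh_le_imp_le)
        show "0 < r" using T r by linarith
        show "x + \<mu> *\<^sub>R (w - x) \<in> W"
          if "w \<in> V n" "norm w \<le> norm x + (1 + exp (2 * (D + artanh r))) * max M 0" for w
          using elim that by (simp add: R_def)
      qed
      then obtain L' where L': "L' \<le> (1 + \<eta>) * L" "disc_chain W L' x (x + \<mu> *\<^sub>R (y - x))" by blast
      have "kobayashi_dist W x y \<le>
          kobayashi_dist W x (x + \<mu> *\<^sub>R (y - x)) + kobayashi_dist W (x + \<mu> *\<^sub>R (y - x)) y"
        using W xy d(2)[OF \<mu>(3)] by (intro kobayashi_dist_triangle) auto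
      also have "\<dots> < L' + e / 4"
        using kobayashi_dist_le[OF L'(2)] d(2)[OF \<mu>(3)] by linarith
      also have "\<dots> \<le> L + \<eta> * L + e / 4" using L'(1) by (simp add: distrib_right)
      also have "\<eta> * L \<le> \<eta> * D" using \<eta>(1) LD by simp
      also have "\<eta> * D \<le> e / 4" by (rule \<eta>(2))
      finally show ?case using L(2) \<open>e > 0\<close> by linarith
    qed
  qed
  show ?thesis
  proof (rule tendstoI)
    fix e :: real assume "e > 0"
    show "eventually (\<lambda>n. dist (kobayashi_dist (V n) x y) (kobayashi_dist W x y) < e) sequentially"
      using upper[OF \<open>e > 0\<close>] lower[OF \<open>e > 0\<close>]
      by eventually_elim (auto simp: dist_real_def abs_if)
  qed
qed

section \<open>The four-point inequality in the limit\<close>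

theorem theorem1p8:
  fixes \<Omega> \<Omega>' :: "(complex ^ 'd) set"
  assumes "open \<Omega>" "convex \<Omega>" "C_proper \<Omega>"
    and "gromov_hyperbolic \<Omega> (kobayashi_dist \<Omega>)"
    and "open \<Omega>'" "convex \<Omega>'" "C_proper \<Omega>'"
    and "\<exists>A :: nat \<Rightarrow> (complex ^ 'd \<Rightarrow> complex ^ 'd).
           (\<forall>n. complex_affine (A n)) \<and> local_hausdorff_conv (\<lambda>n. A n ` \<Omega>) \<Omega>'"
  shows "gromov_hyperbolic \<Omega>' (kobayashi_dist \<Omega>')"
proof -
  obtain A :: "nat \<Rightarrow> complex ^ 'd \<Rightarrow> complex ^ 'd"
    where A: "\<And>n. complex_affine (A n)" and conv: "local_hausdorff_conv (\<lambda>n. A n ` \<Omega>) \<Omega>'"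
    using assms(8) by blast
  note V = open_convex_complex_affine_image[OF A assms(1,2)]
  obtain \<delta> where \<delta>: "\<delta> \<ge> 0" "\<And>x y z w. x \<in> \<Omega> \<Longrightarrow> y \<in> \<Omega> \<Longrightarrow> z \<in> \<Omega> \<Longrightarrow> w \<in> \<Omega> \<Longrightarrow>
      min (gromov_product (kobayashi_dist \<Omega>) w x y) (gromov_product (kobayashi_dist \<Omega>) w y z) - \<delta>
        \<le> gromov_product (kobayashi_dist \<Omega>) w x z"
    using assms(4) unfolding gromov_hyperbolic_def by blast
  have lim: "(\<lambda>n. gromov_product (kobayashi_dist (A n ` \<Omega>)) w x y)
      \<longlonglongrightarrow> gromov_product (kobayashi_dist \<Omega>') w x y" if "x \<in> \<Omega>'" "y \<in> \<Omega>'" "w \<in> \<Omega>'" for x y w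
    unfolding gromov_product_def
    using that by (intro tendsto_intros kobayashi_dist_tendsto[OF conv V assms(5-7)]) auto
  have "min (gromov_product (kobayashi_dist \<Omega>') w x y) (gromov_product (kobayashi_dist \<Omega>') w y z) - \<delta>
      \<le> gromov_product (kobayashi_dist \<Omega>') w x z"
    if in': "x \<in> \<Omega>'" "y \<in> \<Omega>'" "z \<in> \<Omega>'" "w \<in> \<Omega>'" for x y z w
  proof (rule tendsto_le[OF sequentially_bot])
    show "(\<lambda>n. gromov_product (kobayashi_dist (A n ` \<Omega>)) w x z)
        \<longlonglongrightarrow> gromov_product (kobayashi_dist \<Omega>') w x z"
      using in' by (intro lim)
    show "(\<lambda>n. min (gromov_product (kobayashi_dist (A n ` \<Omega>)) w x y)
          (gromov_product (kobayashi_dist (A n ` \<Omega>)) w y z) - \<delta>)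
        \<longlonglongrightarrow> min (gromov_product (kobayashi_dist \<Omega>') w x y) (gromov_product (kobayashi_dist \<Omega>') w y z) - \<delta>"
      using in' by (intro tendsto_intros tendsto_min lim)
    \<comment> \<open>Once the four points lie in the image of \<open>\<Omega>\<close> under
      \<open>A n\<close>, they pull back to \<open>\<Omega>\<close>, and affine invariance transfers
      the inequality with the same \<open>\<delta>\<close>.\<close>
    have "eventually (\<lambda>n. {x, y, z, w} \<subseteq> A n ` \<Omega>) sequentially"
      using in' by (intro local_hausdorff_conv_compact_subset[OF conv V(2,1) assms(5)]) auto
    then show "eventually (\<lambda>n. min (gromov_product (kobayashi_dist (A n ` \<Omega>)) w x y)
          (gromov_product (kobayashi_dist (A n ` \<Omega>)) w y z) - \<delta>
        \<le> gromov_product (kobayashi_dist (A n ` \<Omega>)) w x z) sequentially"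
    proof eventually_elim
      case (elim n)
      then obtain x' y' z' w' where "x' \<in> \<Omega>" "y' \<in> \<Omega>" "z' \<in> \<Omega>" "w' \<in> \<Omega>"
        "x = A n x'" "y = A n y'" "z = A n z'" "w = A n w'" by auto
      then show ?case
        using \<delta>(2)[of x' y' z' w'] by (simp add: gromov_product_def kobayashi_dist_complex_affine[OF A])
    qed
  qed
  then show ?thesis unfolding gromov_hyperbolic_def using \<delta>(1) by blast
qed

end
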